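(* Let $\mu,\omega:\mathbb{Z}\to\mathbb{R}^+$ be growth rates such that $\mu$ is faster than $\omega$. If the system $x(k+1)=A(k)x(k)$, $k\in\mathbb{Z}$, has $\omega$-bounded growth, then $\Sigma_{\mu\mathrm{D}}(A)=\{0\}$.
   Context: System: $A:\mathbb{Z}\to GL_d(\mathbb{R})$, and $x(k+1)=A(k)x(k)$, $k\in\mathbb{Z}$. Its evolution operator is $\Phi(k,n)=A(k-1)\cdots A(n)$ for $k>n$, $\Phi(n,n)=\mathrm{Id}$, $\Phi(k,n)=A^{-1}(k)\cdots A^{-1}(n-1)$ for $k<n$. Growth rate: a non-decreasing map $\mu:\mathbb{Z}\to\mathbb{R}^+=(0,\infty)$ with $\mu(0)=1$, $\lim_{n\to+\infty}\mu(n)=+\infty$, $\lim_{n\to-\infty}\mu(n)=0$. Faster: $\mu$ is faster than $\omega$ if for every $\alpha,\tilde\alpha<0$ there is $M\ge1$ such that $\left(\frac{\mu(k)}{\mu(n)}\right)^{\alpha}\le M\left(\frac{\omega(k)}{\omega(n)}\right)^{\tilde\alpha}$ for all integers $k\ge n$. $\omega$-bounded growth: there are constants $\hat K\ge1$, $a\ge0$ with $\|\Phi(k,n)\|\le\hat K\left(\frac{\omega(k)}{\omega(n)}\right)^{\mathrm{sgn}(k-n)a}$ for all $k,n\in\mathbb{Z}$, where $\mathrm{sgn}(j)=1,0,-1$ for $j>0$, $j=0$, $j<0$ respectively. Invariant projector: a map $n\mapsto \mathrm{P}(n)$ of idempotent $d\times d$ matrices with $A(k)\mathrm{P}(k)=\mathrm{P}(k+1)A(k)$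 for all $k\in\mathbb{Z}$. $\mu$-dichotomy ($\mu$D): there are an invariant projector $\mathrm{P}$ and constants $K\ge1$, $\alpha<0$, $\beta>0$ with $\|\Phi(k,n)\mathrm{P}(n)\|\le K\left(\frac{\mu(k)}{\mu(n)}\right)^{\alpha}$ for all $k\ge n$ and $\|\Phi(k,n)[\mathrm{Id}-\mathrm{P}(n)]\|\le K\left(\frac{\mu(k)}{\mu(n)}\right)^{\beta}$ for all $k\le n$. Weighted system: for $\gamma\in\mathbb{R}$ the $(\mu,\gamma)$-weighted system is $x(k+1)=A(k)\left(\frac{\mu(k+1)}{\mu(k)}\right)^{-\gamma}x(k)$. By convention, the weighted system for $\gamma=+\infty$ admits $\mu$D if there is $\hat\gamma\in\mathbb{R}$ such that the $(\mu,\hat\gamma)$-weighted system admits $\mu$D with projector $\mathrm{P}\equiv\mathrm{Id}$; for $\gamma=-\infty$ it admits $\mu$D if there is $\hat\gamma\in\mathbb{R}$ such that the $(\mu,\hat\gamma)$-weighted system admits $\mu$D with projector $\mathrm{P}\equiv0$. Spectrum: $\Sigma_{\mu\mathrm{D}}(A)=\{\gamma\in\mathbb{R}\cup\{\pm\infty\}:\text{the }(\mu,\gamma)\text{-weighted system does not admit }\mu\mathrm{D}\}$. *)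

theory Defs
  imports "HOL-Analysis.Analysis"
begin

text \<open>The norm on \<open>real^'d^'d\<close> provided by the library is the Frobenius norm; matrices are
  measured here by the operator norm induced by the Euclidean norm.\<close>

definition opnorm :: "real^'d^'d \<Rightarrow> real" where
  "opnorm M = onorm ((*v) M)"

definition GL_system :: "(int \<Rightarrow> real^'d^'d) \<Rightarrow> bool" where
  "GL_system A \<longleftrightarrow> (\<forall>k. invertible (A k))"

text \<open>\<open>evol_fwd A n m\<close> is \<open>A (n + m - 1) ** \<dots> ** A n\<close> and \<open>evol_bwd A n m\<close> is
  \<open>(A (n - m))\<inverse> ** \<dots> ** (A (n - 1))\<inverse>\<close>, both with \<open>m\<close> factors.\<close>

primrec evol_fwd :: "(int \<Rightarrow> real^'d^'d) \<Rightarrow> int \<Rightarrow> nat \<Rightarrow> real^'d^'d" where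
  "evol_fwd A n 0 = mat 1"
| "evol_fwd A n (Suc m) = A (n + int m) ** evol_fwd A n m"

primrec evol_bwd :: "(int \<Rightarrow> real^'d^'d) \<Rightarrow> int \<Rightarrow> nat \<Rightarrow> real^'d^'d" where
  "evol_bwd A n 0 = mat 1"
| "evol_bwd A n (Suc m) = matrix_inv (A (n - int (Suc m))) ** evol_bwd A n m"

definition evol :: "(int \<Rightarrow> real^'d^'d) \<Rightarrow> int \<Rightarrow> int \<Rightarrow> real^'d^'d" where
  "evol A k n = (if n \<le> k then evol_fwd A n (nat (k - n)) else evol_bwd A n (nat (n - k)))"

definition growth_rate :: "(int \<Rightarrow> real) \<Rightarrow> bool" where
  "growth_rate \<mu> \<longleftrightarrow> mono \<mu> \<and> (\<forall>n. \<mu> n > 0) \<and> \<mu> 0 = 1 \<and>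
     filterlim \<mu> at_top at_top \<and> (\<mu> \<longlongrightarrow> 0) at_bot"

definition faster :: "(int \<Rightarrow> real) \<Rightarrow> (int \<Rightarrow> real) \<Rightarrow> bool" where
  "faster \<mu> \<omega> \<longleftrightarrow> (\<forall>\<alpha><0. \<forall>\<alpha>'<0. \<exists>M\<ge>1. \<forall>k n. n \<le> k \<longrightarrow>
     (\<mu> k / \<mu> n) powr \<alpha> \<le> M * (\<omega> k / \<omega> n) powr \<alpha>')"

definition bounded_growth :: "(int \<Rightarrow> real) \<Rightarrow> (int \<Rightarrow> real^'d^'d) \<Rightarrow> bool" where
  "bounded_growth \<omega> A \<longleftrightarrow> (\<exists>K\<ge>1. \<exists>a\<ge>0. \<forall>k n.
     opnorm (evol A k n) \<le> K * (\<omega> k / \<omega> n) powr (of_int (sgn (k - n)) * a))"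

definition invariant_projector :: "(int \<Rightarrow> real^'d^'d) \<Rightarrow> (int \<Rightarrow> real^'d^'d) \<Rightarrow> bool" where
  "invariant_projector A P \<longleftrightarrow>
     (\<forall>n. P n ** P n = P n) \<and> (\<forall>k. A k ** P k = P (k + 1) ** A k)"

definition dichotomy_with ::
    "(int \<Rightarrow> real) \<Rightarrow> (int \<Rightarrow> real^'d^'d) \<Rightarrow> (int \<Rightarrow> real^'d^'d) \<Rightarrow> bool" where
  "dichotomy_with \<mu> A P \<longleftrightarrow> invariant_projector A P \<and>
     (\<exists>K\<ge>1. \<exists>\<alpha><0. \<exists>\<beta>>0.
        (\<forall>k n. n \<le> k \<longrightarrow> opnorm (evol A k n ** P n) \<le> K * (\<mu> k / \<mu> n) powr \<alpha>) \<and>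
        (\<forall>k n. k \<le> n \<longrightarrow> opnorm (evol A k n ** (mat 1 - P n)) \<le> K * (\<mu> k / \<mu> n) powr \<beta>))"

definition admits_dichotomy :: "(int \<Rightarrow> real) \<Rightarrow> (int \<Rightarrow> real^'d^'d) \<Rightarrow> bool" where
  "admits_dichotomy \<mu> A \<longleftrightarrow> (\<exists>P. dichotomy_with \<mu> A P)"

definition weighted ::
    "(int \<Rightarrow> real) \<Rightarrow> real \<Rightarrow> (int \<Rightarrow> real^'d^'d) \<Rightarrow> int \<Rightarrow> real^'d^'d" where
  "weighted \<mu> \<gamma> A k = ((\<mu> (k + 1) / \<mu> k) powr (- \<gamma>)) *\<^sub>R A k"

text \<open>For infinite \<open>\<gamma>\<close> there is no weighted system; what it means for it to admit a
  dichotomy is a convention.\<close>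

definition weighted_admits_dichotomy ::
    "(int \<Rightarrow> real) \<Rightarrow> (int \<Rightarrow> real^'d^'d) \<Rightarrow> ereal \<Rightarrow> bool" where
  "weighted_admits_dichotomy \<mu> A \<gamma> = (case \<gamma> of
       ereal r \<Rightarrow> admits_dichotomy \<mu> (weighted \<mu> r A)
     | PInfty \<Rightarrow> (\<exists>r. dichotomy_with \<mu> (weighted \<mu> r A) (\<lambda>_. mat 1))
     | MInfty \<Rightarrow> (\<exists>r. dichotomy_with \<mu> (weighted \<mu> r A) (\<lambda>_. 0)))"

definition dichotomy_spectrum :: "(int \<Rightarrow> real) \<Rightarrow> (int \<Rightarrow> real^'d^'d) \<Rightarrow> ereal set" where
  "dichotomy_spectrum \<mu> A = {\<gamma>. \<not> weighted_admits_dichotomy \<mu> A \<gamma>}"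

end

theory Submission
  imports Defs
begin

text \<open>Because \<open>\<mu>\<close> outgrows every power of \<open>\<omega>\<close>, \<open>\<omega>\<close>-bounded growth makes the
  evolution operator and its inverse grow more slowly than every positive power of \<open>\<mu>\<close>
  (\<open>bounded_growth_subpolynomial\<close>). The spectrum can be read off from this alone.

  Weighting by \<open>\<gamma>\<close> multiplies \<open>\<Phi>(k,n)\<close> by \<open>(\<mu>(k)/\<mu>(n))\<^sup>-\<^sup>\<gamma>\<close>. If \<open>\<gamma> > 0\<close>, half of this factor
  absorbs the growth of \<open>\<Phi>(k,n)\<close> and the other half is left over as decay for \<open>k \<ge> n\<close>, so the
  weighted system has a dichotomy with projector \<open>Id\<close>; if \<open>\<gamma> < 0\<close>, the same happens in backward
  time, with projector \<open>0\<close>. These two cases also settle \<open>\<gamma> = \<plusminus>\<infinity>\<close>.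

  For \<open>\<gamma> = 0\<close> the system is unchanged. If it had a dichotomy, then
  \<open>P(n) = \<Phi>(n,k) \<Phi>(k,n) P(n)\<close> would tend to \<open>0\<close> as \<open>k \<rightarrow> \<infinity>\<close>, since the decay of
  \<open>\<Phi>(k,n) P(n)\<close> beats the growth of \<open>\<Phi>(n,k)\<close>; hence \<open>P(n) = 0\<close>. Letting \<open>k \<rightarrow> -\<infinity>\<close> gives
  \<open>Id - P(n) = 0\<close> in the same way, and these are contradictory because the dimension is
  positive.\<close>

section \<open>The operator norm\<close>

lemma opnorm_nonneg: "0 \<le> opnorm M"
  unfolding opnorm_def by (simp add: onorm_pos_le matrix_vector_mul_bounded_linear)

lemma opnorm_0 [simp]: "opnorm (0 :: real^'d^'d) = 0"
proof -
  have "(*v) (0 :: real^'d^'d) = (\<lambda>_. 0)"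
    by (simp add: fun_eq_iff)
  then show ?thesis
    by (simp add: opnorm_def onorm_zero)
qed

lemma opnorm_eq_0_imp:
  assumes "opnorm (M :: real^'d^'d) = 0"
  shows "M = 0"
proof -
  have "(*v) M = (\<lambda>_. 0)"
    using assms onorm_eq_0[OF matrix_vector_mul_bounded_linear[of M]]
    by (auto simp: opnorm_def)
  then show ?thesis
    by (metis matrix_eq matrix_vector_mult_0)
qed

lemma opnorm_mult_le: "opnorm (M ** N) \<le> opnorm M * opnorm N"
proof -
  have "(*v) (M ** N) = (*v) M \<circ> (*v) N"
    by (simp add: fun_eq_iff matrix_vector_mul_assoc)
  then show ?thesis
    by (simp add: opnorm_def onorm_compose matrix_vector_mul_bounded_linear)
qed

lemma opnorm_scaleR: "opnorm (c *\<^sub>R M) = \<bar>c\<bar> * opnorm M"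
proof -
  have "(*v) (c *\<^sub>R M) = (\<lambda>x. c *\<^sub>R (M *v x))"
    by (simp add: fun_eq_iff scaleR_matrix_vector_assoc)
  then show ?thesis
    by (simp add: opnorm_def onorm_scaleR matrix_vector_mul_bounded_linear)
qed

section \<open>Inverses and scalar multiples of matrices\<close>

lemma
  assumes "invertible A"
  shows matrix_inv_right: "A ** matrix_inv A = mat 1"
    and matrix_inv_left: "matrix_inv A ** A = mat 1"
  using someI_ex[OF assms[unfolded invertible_def]] by (auto simp: matrix_inv_def)

lemma matrix_inv_unique:
  assumes "A ** B = mat 1" "B ** A = mat 1"
  shows "matrix_inv A = B"
proof -
  have "invertible A"
    using assms by (auto simp: invertible_def)
  then have "B ** A ** matrix_inv A = B"
    by (simp add: matrix_inv_right flip: matrix_mul_assoc)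
  with assms show ?thesis
    by simp
qed

lemma scaleR_matrix_mult_left: "(c *\<^sub>R A) ** B = c *\<^sub>R (A ** B)"
  for A :: "real^'m^'n"
  by (rule scalar_matrix_assoc[symmetric])

lemma scaleR_matrix_mult_right: "A ** (c *\<^sub>R B) = c *\<^sub>R (A ** B)"
  for A :: "real^'m^'n"
  by (simp add: matrix_scalar_ac scaleR_matrix_mult_left)

lemma matrix_inv_scaleR:
  fixes A :: "real^'d^'d"
  assumes "invertible A" "c \<noteq> 0"
  shows "matrix_inv (c *\<^sub>R A) = inverse c *\<^sub>R matrix_inv A"
proof (rule matrix_inv_unique)
  show "(c *\<^sub>R A) ** (inverse c *\<^sub>R matrix_inv A) = mat 1"
       "(inverse c *\<^sub>R matrix_inv A) ** (c *\<^sub>R A) = mat 1"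
    using assms
    by (simp_all add: scaleR_matrix_mult_left scaleR_matrix_mult_right
        matrix_inv_left matrix_inv_right)
qed

section \<open>The evolution operator\<close>

text \<open>The defining recursion extends a product at its newest factor; cancelling a forward product
  against a backward one needs the recursion at the oldest factor.\<close>

lemma evol_fwd_Suc_right: "evol_fwd A n (Suc m) = evol_fwd A (n + 1) m ** A n"
  by (induction m) (simp_all add: matrix_mul_assoc add_ac)

lemma evol_bwd_fwd:
  assumes "GL_system A"
  shows "evol_bwd A (n + int m) m ** evol_fwd A n m = mat 1"
proof (induction m arbitrary: n)
  case 0
  then show ?case by simp
next
  case (Suc m)
  have inv: "matrix_inv (A n) ** A n = mat 1"
    using assms matrix_inv_left by (auto simp: GL_system_def)
  have "evol_bwd A (n + int (Suc m)) (Suc m) ** evol_fwd A n (Suc m)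
      = matrix_inv (A n) ** (evol_bwd A (n + 1 + int m) m ** evol_fwd A (n + 1) m) ** A n"
    by (simp only: evol_fwd_Suc_right) (simp add: matrix_mul_assoc add_ac)
  also have "\<dots> = mat 1"
    by (simp only: Suc.IH matrix_mul_rid inv)
  finally show ?case .
qed

lemma evol_inverse:
  assumes "GL_system A"
  shows "evol A n k ** evol A k n = mat 1"
proof -
  have *: "evol A n k ** evol A k n = mat 1" if "n \<le> k" for n k
    using evol_bwd_fwd[OF assms, of n "nat (k - n)"] that by (auto simp: evol_def)
  show ?thesis
  proof (cases "n \<le> k")
    case False
    then have "evol A k n ** evol A n k = mat 1"
      using * by simp
    then show ?thesis
      by (simp add: matrix_left_right_inverse)
  qed (rule *)
qed

text \<open>The weights telescope along the product. Backward, inverting a factor of the product inverts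
  its weight, which is why the same formula covers \<open>k < n\<close>.\<close>

lemma evol_weighted:
  fixes A :: "int \<Rightarrow> real^'d^'d"
  assumes pos: "\<And>n. \<mu> n > 0" and GL: "GL_system A"
  shows "evol (weighted \<mu> \<gamma> A) k n = (\<mu> k / \<mu> n) powr (- \<gamma>) *\<^sub>R evol A k n"
proof -
  have nz: "\<mu> n \<noteq> 0" for n
    using pos[of n] by simp
  have fwd: "evol_fwd (weighted \<mu> \<gamma> A) n m
      = (\<mu> (n + int m) / \<mu> n) powr (- \<gamma>) *\<^sub>R evol_fwd A n m" for m
  proof (induction m)
    case (Suc m)
    have "(\<mu> (n + int m + 1) / \<mu> (n + int m)) powr (- \<gamma>) * (\<mu> (n + int m) / \<mu> n) powr (- \<gamma>)
        = (\<mu> (n + int (Suc m)) / \<mu> n) powr (- \<gamma>)"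
      using pos[of "n + int m + 1"] pos[of "n + int m"] pos[of n]
      by (simp add: powr_divide add_ac)
    with Suc show ?case
      by (simp add: weighted_def scaleR_matrix_mult_left scaleR_matrix_mult_right mult_ac)
  qed (simp add: nz)
  have bwd: "evol_bwd (weighted \<mu> \<gamma> A) n m
      = (\<mu> (n - int m) / \<mu> n) powr (- \<gamma>) *\<^sub>R evol_bwd A n m" for m
  proof (induction m)
    case (Suc m)
    let ?j = "n - int (Suc m)"
    have j: "?j + 1 = n - int m"
      by simp
    have c: "inverse ((\<mu> (?j + 1) / \<mu> ?j) powr (- \<gamma>)) * (\<mu> (n - int m) / \<mu> n) powr (- \<gamma>)
        = (\<mu> ?j / \<mu> n) powr (- \<gamma>)"
      unfolding j using pos[of ?j] pos[of n] pos[of "n - int m"]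
      by (simp add: powr_divide powr_minus divide_simps)
    have "matrix_inv (weighted \<mu> \<gamma> A ?j)
        = inverse ((\<mu> (?j + 1) / \<mu> ?j) powr (- \<gamma>)) *\<^sub>R matrix_inv (A ?j)"
      unfolding weighted_def using GL nz
      by (intro matrix_inv_scaleR) (auto simp: GL_system_def)
    then have "evol_bwd (weighted \<mu> \<gamma> A) n (Suc m)
        = (inverse ((\<mu> (?j + 1) / \<mu> ?j) powr (- \<gamma>)) * (\<mu> (n - int m) / \<mu> n) powr (- \<gamma>))
          *\<^sub>R evol_bwd A n (Suc m)"
      using Suc by (simp add: scaleR_matrix_mult_left scaleR_matrix_mult_right mult_ac)
    then show ?case
      by (simp only: c)
  qed (simp add: nz)
  show ?thesis
    by (simp add: evol_def fwd bwd)
qed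

lemma weighted_0:
  assumes "\<And>n. \<mu> n > 0"
  shows "weighted \<mu> 0 A = A"
proof
  show "weighted \<mu> 0 A k = A k" for k
    using assms[of k] assms[of "k + 1"] by (simp add: weighted_def)
qed

section \<open>Growth of the evolution operator\<close>

text \<open>For \<open>n \<le> k\<close>, \<open>\<Phi>(k,n)\<close> and its inverse are bounded by a constant times \<open>(\<omega>(k)/\<omega>(n))\<^sup>a\<close> for
  one fixed \<open>a\<close>, and the growth rate \<open>\<mu>\<close>, raised to however small an exponent \<open>\<epsilon>\<close>, dominates any
  such power.\<close>

lemma bounded_growth_subpolynomial:
  assumes \<mu>: "growth_rate \<mu>" and \<omega>: "growth_rate \<omega>" and f: "faster \<mu> \<omega>"
    and b: "bounded_growth \<omega> A" and "\<epsilon> > 0"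
  shows "\<exists>C\<ge>1. \<forall>k n. n \<le> k \<longrightarrow>
    opnorm (evol A k n) \<le> C * (\<mu> k / \<mu> n) powr \<epsilon> \<and>
    opnorm (evol A n k) \<le> C * (\<mu> k / \<mu> n) powr \<epsilon>"
proof -
  have pos: "\<mu> n > 0" "\<omega> n > 0" for n
    using \<mu> \<omega> by (auto simp: growth_rate_def)
  obtain K a where K: "K \<ge> 1" "a \<ge> 0"
    and bound: "\<And>k n. opnorm (evol A k n) \<le> K * (\<omega> k / \<omega> n) powr (of_int (sgn (k - n)) * a)"
    using b by (auto simp: bounded_growth_def)
  \<comment> \<open>The exponent is raised from \<open>a\<close> to \<open>a + 1\<close> because \<open>faster\<close> speaks of strictly negative
    exponents only, while \<open>a\<close> may be \<open>0\<close>.\<close>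
  obtain M where M: "M \<ge> 1" and
    fast: "\<And>k n. n \<le> k \<Longrightarrow> (\<mu> k / \<mu> n) powr (- \<epsilon>) \<le> M * (\<omega> k / \<omega> n) powr (- (a + 1))"
    using f \<open>\<epsilon> > 0\<close> K(2) unfolding faster_def
    by (metis add_nonneg_pos neg_less_0_iff_less zero_less_one)
  have "opnorm (evol A k n) \<le> K * M * (\<mu> k / \<mu> n) powr \<epsilon> \<and>
      opnorm (evol A n k) \<le> K * M * (\<mu> k / \<mu> n) powr \<epsilon>" if "n \<le> k" for k n
  proof -
    have "\<omega> n \<le> \<omega> k"
      using \<omega> that by (auto simp: growth_rate_def mono_def)
    then have ge1: "\<omega> k / \<omega> n \<ge> 1"
      using pos(2) by simp
    have "(\<omega> k / \<omega> n) powr (a + 1) \<le> M * (\<mu> k / \<mu> n) powr \<epsilon>"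
    proof -
      have p: "(\<mu> k / \<mu> n) powr \<epsilon> > 0" "(\<omega> k / \<omega> n) powr (a + 1) > 0"
        using pos[of k] pos[of n] by simp_all
      have "inverse ((\<mu> k / \<mu> n) powr \<epsilon>) \<le> M * inverse ((\<omega> k / \<omega> n) powr (a + 1))"
        using fast[OF that] unfolding powr_minus .
      with p show ?thesis
        by (simp add: field_simps)
    qed
    moreover have "(\<omega> k / \<omega> n) powr b' \<le> (\<omega> k / \<omega> n) powr (a + 1)" if "b' \<le> a" for b'
      using ge1 that by (intro powr_mono) auto
    ultimately have le: "K * (\<omega> k / \<omega> n) powr b' \<le> K * M * (\<mu> k / \<mu> n) powr \<epsilon>" if "b' \<le> a" for b'
      using K(1) that by (simp add: mult.assoc) (meson order_trans)
    have "opnorm (evol A k n) \<le> K * (\<omega> k / \<omega> n) powr (of_int (sgn (k - n)) * a)"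
      by (rule bound)
    also have "\<dots> \<le> K * M * (\<mu> k / \<mu> n) powr \<epsilon>"
      using that K(2) by (intro le) (auto simp: sgn_if)
    finally have 1: "opnorm (evol A k n) \<le> K * M * (\<mu> k / \<mu> n) powr \<epsilon>" .
    have "opnorm (evol A n k) \<le> K * (\<omega> n / \<omega> k) powr (of_int (sgn (n - k)) * a)"
      by (rule bound)
    also have "(\<omega> n / \<omega> k) powr (of_int (sgn (n - k)) * a)
        = (\<omega> k / \<omega> n) powr (of_int (sgn (k - n)) * a)"
      using pos(2)[of k] pos(2)[of n]
      by (auto simp: sgn_if powr_divide powr_minus divide_simps)
    also have "K * \<dots> \<le> K * M * (\<mu> k / \<mu> n) powr \<epsilon>"
      using that K(2) by (intro le) (auto simp: sgn_if)
    finally show ?thesis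
      using 1 by simp
  qed
  moreover have "K * M \<ge> 1"
    using K(1) M mult_mono[of 1 K 1 M] by simp
  ultimately show ?thesis
    by blast
qed

section \<open>Nonzero weights\<close>

text \<open>A positive weight contributes \<open>(\<mu>(k)/\<mu>(n))\<^sup>-\<^sup>\<gamma>\<close>, and \<open>\<Phi>(k,n)\<close> grows at most like
  \<open>(\<mu>(k)/\<mu>(n))\<^sup>\<gamma>\<^sup>/\<^sup>2\<close> for \<open>k \<ge> n\<close>, so the exponent \<open>-\<gamma>/2\<close> remains for all solutions.\<close>

lemma weighted_dichotomy_pos:
  assumes \<mu>: "growth_rate \<mu>" and \<omega>: "growth_rate \<omega>" and f: "faster \<mu> \<omega>"
    and GL: "GL_system A" and b: "bounded_growth \<omega> A" and "\<gamma> > 0"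
  shows "dichotomy_with \<mu> (weighted \<mu> \<gamma> A) (\<lambda>_. mat 1)"
proof -
  have pos: "\<mu> n > 0" for n
    using \<mu> by (auto simp: growth_rate_def)
  have half: "\<gamma> / 2 > 0"
    using \<open>\<gamma> > 0\<close> by simp
  obtain C where C: "C \<ge> 1"
    "\<And>k n. n \<le> k \<Longrightarrow> opnorm (evol A k n) \<le> C * (\<mu> k / \<mu> n) powr (\<gamma> / 2)"
    "\<And>k n. n \<le> k \<Longrightarrow> opnorm (evol A n k) \<le> C * (\<mu> k / \<mu> n) powr (\<gamma> / 2)"
    using bounded_growth_subpolynomial[OF \<mu> \<omega> f b half] by blast
  have "opnorm (evol (weighted \<mu> \<gamma> A) k n) \<le> C * (\<mu> k / \<mu> n) powr (- (\<gamma> / 2))"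
    if "n \<le> k" for k n
  proof -
    have "opnorm (evol (weighted \<mu> \<gamma> A) k n) = (\<mu> k / \<mu> n) powr (- \<gamma>) * opnorm (evol A k n)"
      by (simp add: evol_weighted[OF pos GL] opnorm_scaleR)
    also have "\<dots> \<le> (\<mu> k / \<mu> n) powr (- \<gamma>) * (C * (\<mu> k / \<mu> n) powr (\<gamma> / 2))"
      using C(2)[OF that] by (intro mult_left_mono) auto
    also have "\<dots> = C * ((\<mu> k / \<mu> n) powr (- \<gamma> + \<gamma> / 2))"
      unfolding powr_add by simp
    also have "- \<gamma> + \<gamma> / 2 = - (\<gamma> / 2)"
      by simp
    finally show ?thesis .
  qed
  moreover have "invariant_projector (weighted \<mu> \<gamma> A) (\<lambda>_. mat 1)"
    by (simp add: invariant_projector_def)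
  ultimately show ?thesis
    unfolding dichotomy_with_def using C(1) half
    by (intro conjI exI[of _ C] exI[of _ "- (\<gamma> / 2)"] exI[of _ 1]) auto
qed

text \<open>The time-reversed argument: for \<open>k \<le> n\<close> the weight \<open>(\<mu>(k)/\<mu>(n))\<^sup>-\<^sup>\<gamma>\<close> has a positive
  exponent and a base at most \<open>1\<close>, and \<open>\<Phi>(k,n)\<close> uses up half of this decay.\<close>

lemma weighted_dichotomy_neg:
  assumes \<mu>: "growth_rate \<mu>" and \<omega>: "growth_rate \<omega>" and f: "faster \<mu> \<omega>"
    and GL: "GL_system A" and b: "bounded_growth \<omega> A" and "\<gamma> < 0"
  shows "dichotomy_with \<mu> (weighted \<mu> \<gamma> A) (\<lambda>_. 0)"
proof -
  have pos: "\<mu> n > 0" for n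
    using \<mu> by (auto simp: growth_rate_def)
  have half: "- (\<gamma> / 2) > 0"
    using \<open>\<gamma> < 0\<close> by simp
  obtain C where C: "C \<ge> 1"
    "\<And>k n. n \<le> k \<Longrightarrow> opnorm (evol A k n) \<le> C * (\<mu> k / \<mu> n) powr (- (\<gamma> / 2))"
    "\<And>k n. n \<le> k \<Longrightarrow> opnorm (evol A n k) \<le> C * (\<mu> k / \<mu> n) powr (- (\<gamma> / 2))"
    using bounded_growth_subpolynomial[OF \<mu> \<omega> f b half] by blast
  have "opnorm (evol (weighted \<mu> \<gamma> A) k n) \<le> C * (\<mu> k / \<mu> n) powr (- (\<gamma> / 2))"
    if "k \<le> n" for k n
  proof -
    have inv: "(\<mu> n / \<mu> k) powr (- (\<gamma> / 2)) = (\<mu> k / \<mu> n) powr (\<gamma> / 2)"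
      using pos[of k] pos[of n] by (simp add: powr_divide powr_minus divide_simps)
    have "opnorm (evol (weighted \<mu> \<gamma> A) k n) = (\<mu> k / \<mu> n) powr (- \<gamma>) * opnorm (evol A k n)"
      by (simp add: evol_weighted[OF pos GL] opnorm_scaleR)
    also have "\<dots> \<le> (\<mu> k / \<mu> n) powr (- \<gamma>) * (C * (\<mu> k / \<mu> n) powr (\<gamma> / 2))"
      using C(3)[OF that] unfolding inv by (intro mult_left_mono) auto
    also have "\<dots> = C * ((\<mu> k / \<mu> n) powr (- \<gamma> + \<gamma> / 2))"
      unfolding powr_add by simp
    also have "- \<gamma> + \<gamma> / 2 = - (\<gamma> / 2)"
      by simp
    finally show ?thesis .
  qed
  moreover have "invariant_projector (weighted \<mu> \<gamma> A) (\<lambda>_. 0)"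
    by (simp add: invariant_projector_def)
  ultimately show ?thesis
    unfolding dichotomy_with_def using C(1) half
    by (intro conjI exI[of _ C] exI[of _ "-1"] exI[of _ "- (\<gamma> / 2)"]) auto
qed

section \<open>Weight zero\<close>

text \<open>The factorisation \<open>Q = \<Phi>(n,k) \<Phi>(k,n) Q\<close> bounds the fixed matrix \<open>Q\<close> by quantities that
  depend on \<open>k\<close> and whose product tends to \<open>0\<close> along \<open>F\<close>. The filter is left open so that \<open>k\<close>
  can tend to \<open>+\<infinity>\<close>, with \<open>r k = \<mu>(n)/\<mu>(k)\<close>, or to \<open>-\<infinity>\<close>, with \<open>r k = \<mu>(k)/\<mu>(n)\<close>.\<close>

lemma eq_0_if_evol_decays:
  assumes GL: "GL_system A"
    and F: "F \<noteq> bot" and r: "(r \<longlongrightarrow> 0) F" and r0: "\<And>k. r k \<ge> 0" and "\<epsilon> > 0"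
    and grow: "\<forall>\<^sub>F k in F. opnorm (evol A n k) \<le> C * r k powr (- \<epsilon>)"
    and decay: "\<forall>\<^sub>F k in F. opnorm (evol A k n ** Q) \<le> K * r k powr (2 * \<epsilon>)"
  shows "Q = 0"
proof -
  have "((\<lambda>k. r k powr \<epsilon>) \<longlongrightarrow> 0) F"
    using r \<open>\<epsilon> > 0\<close> r0 by (intro tendsto_zero_powrI[where b = \<epsilon>]) auto
  then have "((\<lambda>k. C * K * r k powr \<epsilon>) \<longlongrightarrow> 0) F"
    by (rule tendsto_mult_right_zero)
  moreover have "\<forall>\<^sub>F k in F. opnorm Q \<le> C * K * r k powr \<epsilon>"
    using grow decay
  proof eventually_elim
    case (elim k)
    have "opnorm Q = opnorm (evol A n k ** (evol A k n ** Q))"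
      by (simp add: matrix_mul_assoc evol_inverse[OF GL])
    also have "\<dots> \<le> opnorm (evol A n k) * opnorm (evol A k n ** Q)"
      by (rule opnorm_mult_le)
    also have "\<dots> \<le> (C * r k powr (- \<epsilon>)) * (K * r k powr (2 * \<epsilon>))"
      using elim opnorm_nonneg by (intro mult_mono) (auto intro: order_trans)
    also have "\<dots> = C * K * r k powr (- \<epsilon> + 2 * \<epsilon>)"
      unfolding powr_add by simp
    finally show ?case
      by simp
  qed
  ultimately have "opnorm Q \<le> 0"
    using F by (intro tendsto_lowerbound)
  then show ?thesis
    using opnorm_nonneg[of Q] by (intro opnorm_eq_0_imp) linarith
qed

lemma not_admits_dichotomy:
  fixes A :: "int \<Rightarrow> real^'d^'d"
  assumes \<mu>: "growth_rate \<mu>" and \<omega>: "growth_rate \<omega>" and f: "faster \<mu> \<omega>"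
    and GL: "GL_system A" and b: "bounded_growth \<omega> A"
  shows "\<not> admits_dichotomy \<mu> A"
proof
  assume "admits_dichotomy \<mu> A"
  then obtain P K \<alpha> \<beta> where "\<alpha> < 0" "\<beta> > 0"
    and st: "\<And>k n. n \<le> k \<Longrightarrow> opnorm (evol A k n ** P n) \<le> K * (\<mu> k / \<mu> n) powr \<alpha>"
    and un: "\<And>k n. k \<le> n \<Longrightarrow> opnorm (evol A k n ** (mat 1 - P n)) \<le> K * (\<mu> k / \<mu> n) powr \<beta>"
    by (auto simp: admits_dichotomy_def dichotomy_with_def)
  have pos: "\<mu> n > 0" for n
    using \<mu> by (auto simp: growth_rate_def)
  have flip: "(\<mu> k / \<mu> n) powr x = (\<mu> n / \<mu> k) powr (- x)" for k n x
    using pos[of k] pos[of n] by (simp add: powr_divide powr_minus divide_simps)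
  have nonneg: "\<mu> k / \<mu> n \<ge> 0" for k n
    using pos[of k] pos[of n] by simp

  have "P 0 = 0"
  proof -
    have half: "- (\<alpha> / 2) > 0"
      using \<open>\<alpha> < 0\<close> by simp
    obtain C where C: "C \<ge> 1"
      "\<And>k n. n \<le> k \<Longrightarrow> opnorm (evol A k n) \<le> C * (\<mu> k / \<mu> n) powr (- (\<alpha> / 2))"
      "\<And>k n. n \<le> k \<Longrightarrow> opnorm (evol A n k) \<le> C * (\<mu> k / \<mu> n) powr (- (\<alpha> / 2))"
      using bounded_growth_subpolynomial[OF \<mu> \<omega> f b half] by blast
    show ?thesis
    proof (rule eq_0_if_evol_decays[OF GL])
      show "((\<lambda>k. \<mu> 0 / \<mu> k) \<longlongrightarrow> 0) at_top"
        using \<mu> by (intro real_tendsto_divide_at_top[OF tendsto_const]) (auto simp: growth_rate_def)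
      show "- (\<alpha> / 2) > 0"
        by fact
      show "\<forall>\<^sub>F k in at_top. opnorm (evol A 0 k) \<le> C * (\<mu> 0 / \<mu> k) powr (- (- (\<alpha> / 2)))"
        using eventually_ge_at_top[of 0] by eventually_elim (metis C(3) flip)
      show "\<forall>\<^sub>F k in at_top. opnorm (evol A k 0 ** P 0) \<le> K * (\<mu> 0 / \<mu> k) powr (2 * - (\<alpha> / 2))"
        using eventually_ge_at_top[of 0]
      proof eventually_elim
        case (elim k)
        then show ?case
          using st[of 0 k] by (simp add: flip[of k 0])
      qed
    qed (auto simp: nonneg)
  qed
  moreover have "mat 1 - P 0 = 0"
  proof -
    have half: "\<beta> / 2 > 0"
      using \<open>\<beta> > 0\<close> by simp
    obtain C where C: "C \<ge> 1"
      "\<And>k n. n \<le> k \<Longrightarrow> opnorm (evol A k n) \<le> C * (\<mu> k / \<mu> n) powr (\<beta> / 2)"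
      "\<And>k n. n \<le> k \<Longrightarrow> opnorm (evol A n k) \<le> C * (\<mu> k / \<mu> n) powr (\<beta> / 2)"
      using bounded_growth_subpolynomial[OF \<mu> \<omega> f b half] by blast
    show ?thesis
    proof (rule eq_0_if_evol_decays[OF GL])
      show "((\<lambda>k. \<mu> k / \<mu> 0) \<longlongrightarrow> 0) at_bot"
        using \<mu> by (simp add: growth_rate_def)
      show "\<beta> / 2 > 0"
        by fact
      show "\<forall>\<^sub>F k in at_bot. opnorm (evol A 0 k) \<le> C * (\<mu> k / \<mu> 0) powr (- (\<beta> / 2))"
        using eventually_le_at_bot[of 0] by eventually_elim (metis C(2) flip)
      show "\<forall>\<^sub>F k in at_bot. opnorm (evol A k 0 ** (mat 1 - P 0))
          \<le> K * (\<mu> k / \<mu> 0) powr (2 * (\<beta> / 2))"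
        using eventually_le_at_bot[of 0] by eventually_elim (use un[of _ 0] in simp)
    qed (auto simp: nonneg)
  qed
  ultimately have "(mat 1 :: real^'d^'d) = 0"
    by simp
  then have "(mat 1 :: real^'d^'d) $ i $ i = 0" for i
    by simp
  then show False
    by (simp add: mat_def)
qed

section \<open>The spectrum\<close>

theorem theorem3p10:
  fixes \<mu> \<omega> :: "int \<Rightarrow> real" and A :: "int \<Rightarrow> real^'d^'d"
  assumes "growth_rate \<mu>" and "growth_rate \<omega>" and "faster \<mu> \<omega>"
    and "GL_system A" and "bounded_growth \<omega> A"
  shows "dichotomy_spectrum \<mu> A = {0}"
proof -
  have pos: "\<mu> n > 0" for n
    using assms(1) by (auto simp: growth_rate_def)
  note pos_weight = weighted_dichotomy_pos[OF assms]
  note neg_weight = weighted_dichotomy_neg[OF assms]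
  have "weighted_admits_dichotomy \<mu> A \<gamma> \<longleftrightarrow> \<gamma> \<noteq> 0" for \<gamma>
  proof (cases \<gamma>)
    case (real r)
    have "admits_dichotomy \<mu> (weighted \<mu> r A) \<longleftrightarrow> r \<noteq> 0"
      using not_admits_dichotomy[OF assms] pos_weight[of r] neg_weight[of r]
      by (cases r "0 :: real" rule: linorder_cases)
        (auto simp: weighted_0[of \<mu>, OF pos] admits_dichotomy_def)
    with real show ?thesis
      by (simp add: weighted_admits_dichotomy_def zero_ereal_def)
  next
    case PInf
    then show ?thesis
      using pos_weight[of 1] by (auto simp: weighted_admits_dichotomy_def)
  next
    case MInf
    then show ?thesis
      using neg_weight[of "-1"] by (auto simp: weighted_admits_dichotomy_def)
  qed
  then show ?thesis
    by (auto simp: dichotomy_spectrum_def)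
qed

end
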